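(* Let $q$ be a prime power, $n\ge 2$, and let $X$ be the set of generators of the hyperbolic polar space $D_n$, partitioned into the two classes $X_1,X_2$ where two generators lie in the same class iff the dimension of their intersection has the same parity as $n$. Let $d$ be even with $2\le d\le n$, and let $Y\subseteq X$ satisfy $n-\dim(U\cap W)\ge d$ for all distinct $U,W\in Y$. Then there exists $\widehat{Y}\subseteq X_1$ with $|\widehat{Y}|=|Y|$ such that $n-\dim(U\cap W)\ge d$ for all distinct $U,W\in\widehat{Y}$; that is, $\widehat{Y}$ is a $\tfrac d2$-code in the bipartite half $\tfrac12 D_n$.
   Context: $D_n$: the totally singular subspaces of $\mathbb{F}_q^{2n}$ equipped with a nondegenerate hyperbolic quadratic form; generators are the totally singular $n$-subspaces. The bipartite half $\tfrac12D_n$ is the association scheme on $X_1$ with relations $\dim(U\cap W)=n-2j$, $j=0,\dots,\lfloor n/2\rfloor$; a $\delta$-code in it is a subset with no pair in relations $j=1,\dots,\delta-1$. *)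

theory Defs
  imports
    "HOL-Analysis.Cartesian_Space"
    "HOL-Library.Disjoint_Sets"
    "HOL-Number_Theory.Prime_Powers"
begin

definition polar_form :: "('k::field ^ 'm \<Rightarrow> 'k) \<Rightarrow> 'k ^ 'm \<Rightarrow> 'k ^ 'm \<Rightarrow> 'k" where
  "polar_form Q x y = Q (x + y) - Q x - Q y"

definition quadratic_form :: "('k::field ^ 'm \<Rightarrow> 'k) \<Rightarrow> bool" where
  "quadratic_form Q \<longleftrightarrow>
     (\<forall>c x. Q (c *s x) = c\<^sup>2 * Q x) \<and>
     (\<forall>x. Vector_Spaces.linear (*s) (*) (\<lambda>y. polar_form Q x y)) \<and>
     (\<forall>y. Vector_Spaces.linear (*s) (*) (\<lambda>x. polar_form Q x y))"

text \<open>In characteristic 2 this is weaker than nondegeneracy of the polar form.\<close>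

definition nondegenerate :: "('k::field ^ 'm \<Rightarrow> 'k) \<Rightarrow> bool" where
  "nondegenerate Q \<longleftrightarrow> (\<forall>x. Q x = 0 \<and> (\<forall>y. polar_form Q x y = 0) \<longrightarrow> x = 0)"

definition totally_singular :: "('k::field ^ 'm \<Rightarrow> 'k) \<Rightarrow> ('k ^ 'm) set \<Rightarrow> bool" where
  "totally_singular Q U \<longleftrightarrow> vec.subspace U \<and> (\<forall>x\<in>U. Q x = 0)"

definition witt_index :: "('k::field ^ 'm \<Rightarrow> 'k) \<Rightarrow> nat" where
  "witt_index Q = Max {vec.dim U | U. totally_singular Q U}"

definition hyperbolic :: "('k::field ^ 'm \<Rightarrow> 'k) \<Rightarrow> bool" where
  "hyperbolic Q \<longleftrightarrow> CARD('m) = 2 * witt_index Q"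

definition generators :: "('k::field ^ 'm \<Rightarrow> 'k) \<Rightarrow> nat \<Rightarrow> ('k ^ 'm) set set" where
  "generators Q n = {U. totally_singular Q U \<and> vec.dim U = n}"

definition generator_classes ::
    "('k::field ^ 'm \<Rightarrow> 'k) \<Rightarrow> nat \<Rightarrow> ('k ^ 'm) set set \<Rightarrow> ('k ^ 'm) set set \<Rightarrow> bool" where
  "generator_classes Q n X1 X2 \<longleftrightarrow>
     X1 \<noteq> X2 \<and> partition_on (generators Q n) {X1, X2} \<and>
     (\<forall>U\<in>generators Q n. \<forall>W\<in>generators Q n.
        (\<exists>C\<in>{X1, X2}. U \<in> C \<and> W \<in> C) \<longleftrightarrow> (even (vec.dim (U \<inter> W)) \<longleftrightarrow> even n))"

definition half_rel ::
    "nat \<Rightarrow> ('k::field ^ 'm) set set \<Rightarrow> nat \<Rightarrow> (('k ^ 'm) set \<times> ('k ^ 'm) set) set" where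
  "half_rel n X1 j =
     {(U, W). U \<in> X1 \<and> W \<in> X1 \<and> j \<le> n div 2 \<and> vec.dim (U \<inter> W) = n - 2 * j}"

definition half_code ::
    "nat \<Rightarrow> ('k::field ^ 'm) set set \<Rightarrow> nat \<Rightarrow> ('k ^ 'm) set set \<Rightarrow> bool" where
  "half_code n X1 \<delta> Y \<longleftrightarrow>
     Y \<subseteq> X1 \<and> (\<forall>j. 1 \<le> j \<and> j < \<delta> \<longrightarrow> (\<forall>U\<in>Y. \<forall>W\<in>Y. (U, W) \<notin> half_rel n X1 j))"

end

theory Submission
  imports Defs
begin

text \<open>
  If \<open>U\<close> and \<open>W\<close> are distinct generators, then \<open>U + W\<close> is too large to be totally singular, so some
  \<open>u \<in> U\<close> and \<open>w \<in> W\<close> are not orthogonal, and \<open>v = u + w\<close> is nonsingular and not orthogonal to \<open>U\<close>.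
  The reflection in \<open>v\<close> is an isometry moving \<open>U\<close> to a generator that meets \<open>U\<close> in a hyperplane, so it
  interchanges the two classes. Apply it to the members of \<open>Y\<close> outside \<open>X1\<close>. Distances inside each
  class are unchanged. Reflecting one of two generators alters the dimension of their intersection
  by at most one; as the distance between generators of different classes is odd and \<open>d\<close> is even,
  it was at least \<open>d + 1\<close> before, so it remains at least \<open>d\<close>.
\<close>

section \<open>Polar form identities and orthogonal reflections\<close>

lemma polar_form_commute: "polar_form Q x y = polar_form Q y x"
  by (simp add: polar_form_def add.commute)

lemma polar_form_add_left:
  "quadratic_form Q \<Longrightarrow> polar_form Q (x + y) z = polar_form Q x z + polar_form Q y z"
  unfolding quadratic_form_def Vector_Spaces.linear_iff by blast

lemma polar_form_scale_left:
  "quadratic_form Q \<Longrightarrow> polar_form Q (c *s x) y = c * polar_form Q x y"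
  unfolding quadratic_form_def Vector_Spaces.linear_iff by blast

lemma quadratic_form_scale: "quadratic_form Q \<Longrightarrow> Q (c *s x) = c\<^sup>2 * Q x"
  unfolding quadratic_form_def by blast

lemma quadratic_form_add: "Q (x + y) = Q x + Q y + polar_form Q x y"
  by (simp add: polar_form_def)

lemma polar_form_self: "quadratic_form Q \<Longrightarrow> polar_form Q x x = 2 * Q x"
  using quadratic_form_scale[of Q 2 x] vec.scale_left_distrib[of 1 1 x]
  by (simp add: polar_form_def)

text \<open>Dividing by \<open>Q v\<close> instead of \<open>polar_form Q v v = 2 * Q v\<close> lets
  the usual reflection formula cover characteristic 2 as well.\<close>

definition quadratic_reflection :: "('k::field ^ 'm \<Rightarrow> 'k) \<Rightarrow> 'k ^ 'm \<Rightarrow> 'k ^ 'm \<Rightarrow> 'k ^ 'm" where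
  "quadratic_reflection Q v x = x + (- polar_form Q x v / Q v) *s v"

lemma linear_quadratic_reflection:
  assumes "quadratic_form Q"
  shows "Vector_Spaces.linear (*s) (*s) (quadratic_reflection Q v)"
  unfolding Vector_Spaces.linear_iff quadratic_reflection_def
  by (auto simp: polar_form_add_left[OF assms] polar_form_scale_left[OF assms] vec.vector_space_axioms
      vec_eq_iff add_divide_distrib diff_divide_distrib algebra_simps)

text \<open>With \<open>t = - polar_form Q x v / Q v\<close>, the correction terms
  \<open>t\<^sup>2 * Q v\<close> and \<open>t * polar_form Q x v\<close> cancel.\<close>

lemma quadratic_reflection_isometry:
  assumes "quadratic_form Q" and "Q v \<noteq> 0"
  shows "Q (quadratic_reflection Q v x) = Q x"
proof -
  have "polar_form Q x ((- polar_form Q x v / Q v) *s v) = (- polar_form Q x v / Q v) * polar_form Q x v"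
    by (metis polar_form_commute polar_form_scale_left[OF assms(1)])
  then show ?thesis
    using assms(2)
    unfolding quadratic_reflection_def quadratic_form_add quadratic_form_scale[OF assms(1)]
    by (simp add: field_simps power2_eq_square)
qed

text \<open>Since \<open>polar_form Q v v = 2 * Q v\<close>, reflecting negates the polar form with
  \<open>v\<close>, so the second application undoes the shift along \<open>v\<close>.\<close>

lemma quadratic_reflection_involution:
  assumes "quadratic_form Q" and "Q v \<noteq> 0"
  shows "quadratic_reflection Q v (quadratic_reflection Q v x) = x"
proof -
  have "polar_form Q (quadratic_reflection Q v x) v = - polar_form Q x v"
    using assms(2)
    unfolding quadratic_reflection_def polar_form_add_left[OF assms(1)]
      polar_form_scale_left[OF assms(1)] polar_form_self[OF assms(1)]
    by simp
  then show ?thesis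
    by (simp add: quadratic_reflection_def vec_eq_iff)
qed

lemma inj_quadratic_reflection:
  "quadratic_form Q \<Longrightarrow> Q v \<noteq> 0 \<Longrightarrow> inj (quadratic_reflection Q v)"
  by (metis injI quadratic_reflection_involution)

lemma quadratic_reflection_fixes: "polar_form Q x v = 0 \<Longrightarrow> quadratic_reflection Q v x = x"
  by (simp add: quadratic_reflection_def)

section \<open>Reflected subspaces and their intersections\<close>

lemma dim_quadratic_reflection_image:
  assumes "quadratic_form Q" and "Q v \<noteq> 0"
  shows "vec.dim (quadratic_reflection Q v ` S) = vec.dim S"
  using vec.dim_image_eq[OF linear_quadratic_reflection[OF assms(1)]] inj_quadratic_reflection[OF assms]
  by (meson inj_on_subset subset_UNIV)

lemma quadratic_reflection_generators:
  assumes "quadratic_form Q" and "Q v \<noteq> 0" and "U \<in> generators Q n"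
  shows "quadratic_reflection Q v ` U \<in> generators Q n"
proof -
  interpret r: Vector_Spaces.linear "(*s)" "(*s)" "quadratic_reflection Q v"
    by (rule linear_quadratic_reflection[OF assms(1)])
  show ?thesis
    using assms(3) r.subspace_image[of U] quadratic_reflection_isometry[OF assms(1,2)]
    by (auto simp: generators_def totally_singular_def dim_quadratic_reflection_image[OF assms(1,2)])
qed

text \<open>The subspace on the right is the kernel of a linear functional on \<open>S\<close>,
  hence has codimension at most one.\<close>

lemma dim_le_Suc_dim_perp:
  assumes "quadratic_form Q" and "vec.subspace S"
  shows "vec.dim S \<le> Suc (vec.dim {x \<in> S. polar_form Q x v = 0})"
proof (cases "\<exists>u\<in>S. polar_form Q u v \<noteq> 0")
  case True
  then obtain u where u: "u \<in> S" "polar_form Q u v \<noteq> 0" by blast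
  let ?H = "{x \<in> S. polar_form Q x v = 0}"
  have "S \<subseteq> vec.span (insert u ?H)"
  proof
    fix x assume x: "x \<in> S"
    \<comment> \<open>This coefficient makes \<open>x - c u\<close> orthogonal to
      \<open>v\<close>.\<close>
    define c where "c = polar_form Q x v / polar_form Q u v"
    have "x + (- c) *s u \<in> S"
      using assms(2) x u(1) by (intro vec.subspace_add vec.subspace_scale)
    moreover have "polar_form Q (x + (- c) *s u) v = 0"
      using u(2) unfolding polar_form_add_left[OF assms(1)] polar_form_scale_left[OF assms(1)]
      by (simp add: c_def)
    ultimately have "x + (- c) *s u \<in> vec.span (insert u ?H)"
      by (intro vec.span_base) auto
    moreover have "c *s u \<in> vec.span (insert u ?H)"
      by (intro vec.span_scale vec.span_base) auto
    ultimately have "(x + (- c) *s u) + c *s u \<in> vec.span (insert u ?H)"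
      by (rule vec.span_add)
    then show "x \<in> vec.span (insert u ?H)" by simp
  qed
  then have "vec.dim S \<le> vec.dim (insert u ?H)" by (rule vec.dim_mono)
  then show ?thesis by (auto simp: vec.dim_insert split: if_splits)
next
  case False
  then have "{x \<in> S. polar_form Q x v = 0} = S" by blast
  then show ?thesis by simp
qed

text \<open>Vectors of the left-hand intersection orthogonal to \<open>v\<close> are fixed by the
  reflection, so they already lie in \<open>W\<close>; orthogonality to \<open>v\<close> costs at
  most one dimension.\<close>

lemma dim_Int_quadratic_reflection_le:
  assumes "quadratic_form Q" and "Q v \<noteq> 0" and "vec.subspace U" and "vec.subspace W"
  shows "vec.dim (U \<inter> quadratic_reflection Q v ` W) \<le> Suc (vec.dim (U \<inter> W))"
proof -
  interpret r: Vector_Spaces.linear "(*s)" "(*s)" "quadratic_reflection Q v"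
    by (rule linear_quadratic_reflection[OF assms(1)])
  have "{x \<in> U \<inter> quadratic_reflection Q v ` W. polar_form Q x v = 0} \<subseteq> U \<inter> W"
    using quadratic_reflection_fixes quadratic_reflection_involution[OF assms(1,2)] by force
  then have "vec.dim {x \<in> U \<inter> quadratic_reflection Q v ` W. polar_form Q x v = 0} \<le> vec.dim (U \<inter> W)"
    by (rule vec.dim_subset)
  then show ?thesis
    using dim_le_Suc_dim_perp[OF assms(1) vec.subspace_inter[OF assms(3) r.subspace_image[OF assms(4)]], of v]
    by linarith
qed

text \<open>The part of \<open>U\<close> orthogonal to \<open>v\<close> is fixed pointwise, so at
  most one dimension is lost; one is lost because \<open>u\<close> is not in the image.\<close>

lemma dim_Int_quadratic_reflection_self:
  assumes "quadratic_form Q" and "Q v \<noteq> 0" and "totally_singular Q U"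
    and "u \<in> U" and "polar_form Q u v \<noteq> 0"
  shows "Suc (vec.dim (U \<inter> quadratic_reflection Q v ` U)) = vec.dim U"
proof -
  let ?r = "quadratic_reflection Q v"
  have U: "vec.subspace U" using assms(3) by (simp add: totally_singular_def)
  interpret r: Vector_Spaces.linear "(*s)" "(*s)" ?r
    by (rule linear_quadratic_reflection[OF assms(1)])
  have rU: "vec.subspace (?r ` U)" by (rule r.subspace_image[OF U])
  have "u \<notin> ?r ` U"
  proof
    assume "u \<in> ?r ` U"
    then have "?r u \<in> U" using quadratic_reflection_involution[OF assms(1,2)] by force
    then have "?r u - u \<in> U" using U assms(4) by (intro vec.subspace_diff)
    \<comment> \<open>A nonzero multiple of the nonsingular vector \<open>v\<close> would lie in the
      totally singular \<open>U\<close>.\<close>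
    then have "(- polar_form Q u v / Q v) *s v \<in> U" by (simp add: quadratic_reflection_def)
    then have "Q ((- polar_form Q u v / Q v) *s v) = 0"
      using assms(3) unfolding totally_singular_def by blast
    then show False
      using assms(2,5) unfolding quadratic_form_scale[OF assms(1)] by simp
  qed
  then have "U \<inter> ?r ` U \<noteq> U" using assms(4) by blast
  then have "vec.dim (U \<inter> ?r ` U) < vec.dim U"
    using vec.subspace_dim_equal[OF vec.subspace_inter[OF U rU] U] by force
  moreover have "vec.dim U \<le> Suc (vec.dim (U \<inter> ?r ` U))"
  proof -
    have "{x \<in> U. polar_form Q x v = 0} \<subseteq> U \<inter> ?r ` U"
      using quadratic_reflection_fixes by force
    then show ?thesis
      using vec.dim_subset dim_le_Suc_dim_perp[OF assms(1) U, of v] by (meson Suc_le_mono le_trans)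
  qed
  ultimately show ?thesis by linarith
qed

section \<open>The Witt index and pairs of generators\<close>

lemma dim_le_witt_index:
  assumes "totally_singular Q U"
  shows "vec.dim U \<le> witt_index Q"
  unfolding witt_index_def
proof (rule Max_ge)
  \<comment> \<open>\<open>Max\<close> is meaningful only on a finite set; the ambient dimension
    bounds this one.\<close>
  show "finite {vec.dim U |U. totally_singular Q U}"
    by (rule finite_subset[of _ "{..vec.dimension TYPE('a) TYPE('b)}"]) (auto simp: vec.dim_subset_UNIV)
qed (use assms in blast)

text \<open>Otherwise \<open>U + W\<close> is totally singular, so its dimension is at most
  \<open>n\<close>, and the dimension formula for sums forces \<open>U = W\<close>.\<close>

lemma distinct_generators_not_orthogonal:
  assumes "witt_index Q \<le> n" and "U \<in> generators Q n" and "W \<in> generators Q n" and "U \<noteq> W"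
  obtains u w where "u \<in> U" and "w \<in> W" and "polar_form Q u w \<noteq> 0"
proof (rule ccontr)
  assume "\<not> thesis"
  with that have orth: "\<And>u w. u \<in> U \<Longrightarrow> w \<in> W \<Longrightarrow> polar_form Q u w = 0" by blast
  have U: "totally_singular Q U" "vec.subspace U" "vec.dim U = n"
    and W: "totally_singular Q W" "vec.subspace W" "vec.dim W = n"
    using assms(2,3) by (auto simp: generators_def totally_singular_def)
  let ?S = "{x + y |x y. x \<in> U \<and> y \<in> W}"
  have "totally_singular Q ?S"
    using U(1) W(1) orth vec.subspace_sums[OF U(2) W(2)]
    by (auto simp: totally_singular_def quadratic_form_add)
  then have "vec.dim ?S \<le> n" using dim_le_witt_index assms(1) by (meson le_trans)
  then have "n \<le> vec.dim (U \<inter> W)" using vec.dim_sums_Int[OF U(2) W(2)] U(3) W(3) by linarith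
  then have "U \<inter> W = U" "U \<inter> W = W"
    using vec.subspace_dim_equal[OF vec.subspace_inter[OF U(2) W(2)]] U W by auto
  then show False using assms(4) by simp
qed

section \<open>Interchanging the two classes\<close>

lemma generator_classesD:
  assumes "generator_classes Q n X1 X2"
  shows "generators Q n = X1 \<union> X2" and "X1 \<inter> X2 = {}" and "X1 \<noteq> {}" and "X2 \<noteq> {}"
    and "\<And>U W. U \<in> generators Q n \<Longrightarrow> W \<in> generators Q n \<Longrightarrow>
           (U \<in> X1 \<longleftrightarrow> W \<in> X1) \<longleftrightarrow> (even (vec.dim (U \<inter> W)) \<longleftrightarrow> even n)"
proof -
  show gen: "generators Q n = X1 \<union> X2" and disj: "X1 \<inter> X2 = {}" and "X1 \<noteq> {}" and "X2 \<noteq> {}"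
    using assms by (auto simp: generator_classes_def partition_on_def disjoint_def)
  fix U W assume UW: "U \<in> generators Q n" "W \<in> generators Q n"
  then have "(\<exists>C\<in>{X1, X2}. U \<in> C \<and> W \<in> C) \<longleftrightarrow> (even (vec.dim (U \<inter> W)) \<longleftrightarrow> even n)"
    using assms unfolding generator_classes_def by blast
  \<comment> \<open>Every generator lies in exactly one class, so membership in \<open>X1\<close>
    decides the class.\<close>
  moreover have "(\<exists>C\<in>{X1, X2}. U \<in> C \<and> W \<in> C) \<longleftrightarrow> (U \<in> X1 \<longleftrightarrow> W \<in> X1)"
    using UW gen disj by blast
  ultimately show "(U \<in> X1 \<longleftrightarrow> W \<in> X1) \<longleftrightarrow> (even (vec.dim (U \<inter> W)) \<longleftrightarrow> even n)"
    by blast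
qed

text \<open>One generator leaving its class suffices: the reflection preserves intersection
  dimensions, hence whether two generators share a class, so all others must switch too.\<close>

lemma class_swapping_reflection:
  assumes "quadratic_form Q" and "witt_index Q \<le> n" and "generator_classes Q n X1 X2"
  obtains v where "Q v \<noteq> 0"
    and "\<And>W. W \<in> generators Q n \<Longrightarrow> quadratic_reflection Q v ` W \<in> X1 \<longleftrightarrow> W \<notin> X1"
proof -
  note classes = generator_classesD[OF assms(3)]
  obtain U U' where UU': "U \<in> X1" "U' \<in> X2" using classes(3,4) by blast
  then have U: "U \<in> generators Q n" and U': "U' \<in> generators Q n" and "U \<noteq> U'"
    using classes(1,2) by auto
  obtain u w where uw: "u \<in> U" "w \<in> U'" "polar_form Q u w \<noteq> 0"
    using distinct_generators_not_orthogonal[OF assms(2) U U' \<open>U \<noteq> U'\<close>] by blast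
  define v where "v = u + w"
  let ?r = "quadratic_reflection Q v"
  have sing: "Q u = 0" "Q w = 0"
    using U U' uw by (auto simp: generators_def totally_singular_def)
  have v: "Q v \<noteq> 0" using uw(3) sing by (simp add: v_def quadratic_form_add)
  \<comment> \<open>The extra term \<open>polar_form Q u u = 2 * Q u\<close> vanishes because
    \<open>u\<close> is singular.\<close>
  have "polar_form Q u v = polar_form Q u w"
    by (metis polar_form_commute polar_form_add_left[OF assms(1)] polar_form_self[OF assms(1)]
        sing(1) mult_zero_right add_0 v_def)
  then have "Suc (vec.dim (U \<inter> ?r ` U)) = n"
    using dim_Int_quadratic_reflection_self[OF assms(1) v _ uw(1)] uw(3) U
    by (simp add: generators_def)
  then have "even (vec.dim (U \<inter> ?r ` U)) \<noteq> even n" by (metis even_Suc)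
  then have rU: "?r ` U \<notin> X1"
    using classes(5)[OF U quadratic_reflection_generators[OF assms(1) v U]] UU'(1) by blast
  have "?r ` W \<in> X1 \<longleftrightarrow> W \<notin> X1" if W: "W \<in> generators Q n" for W
  proof -
    have "?r ` U \<inter> ?r ` W = ?r ` (U \<inter> W)"
      using image_Int[OF inj_quadratic_reflection[OF assms(1) v]] by blast
    then have "vec.dim (?r ` U \<inter> ?r ` W) = vec.dim (U \<inter> W)"
      by (simp add: dim_quadratic_reflection_image[OF assms(1) v])
    then show ?thesis
      using classes(5)[OF U W] UU'(1) rU
        classes(5)[OF quadratic_reflection_generators[OF assms(1) v U]
          quadratic_reflection_generators[OF assms(1) v W]] by auto
  qed
  with v that show thesis by blast
qed

lemma half_codeI:
  assumes "X1 \<subseteq> generators Q n" and "Y \<subseteq> X1" and "d \<le> n"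
    and "\<And>U W. U \<in> Y \<Longrightarrow> W \<in> Y \<Longrightarrow> U \<noteq> W \<Longrightarrow> d \<le> n - vec.dim (U \<inter> W)"
  shows "half_code n X1 (d div 2) Y"
  unfolding half_code_def half_rel_def
proof (intro conjI allI impI ballI notI)
  fix j U W
  assume j: "1 \<le> j \<and> j < d div 2" and UW: "U \<in> Y" "W \<in> Y"
    and "(U, W) \<in> {(U, W). U \<in> X1 \<and> W \<in> X1 \<and> j \<le> n div 2 \<and> vec.dim (U \<inter> W) = n - 2 * j}"
  then have dim: "vec.dim (U \<inter> W) = n - 2 * j" by blast
  moreover have "vec.dim U = n" using UW assms(1,2) by (auto simp: generators_def)
  \<comment> \<open>Here \<open>n\<close> is positive and \<open>j \<ge> 1\<close>, so
    \<open>n - 2 * j\<close> is strictly below \<open>n\<close>, the dimension of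
    \<open>U \<inter> U\<close>.\<close>
  ultimately have "U \<noteq> W" using j assms(3) by force
  then show False using assms(4)[OF UW] dim j by linarith
qed (rule assms(2))

theorem proposition3p3:
  fixes Q :: "'k::{field, finite} ^ 'm \<Rightarrow> 'k"
    and q n d :: nat
    and X1 X2 Y :: "('k ^ 'm) set set"
  assumes "primepow q" and "CARD('k) = q"
    and "n \<ge> 2" and "CARD('m) = 2 * n"
    and "quadratic_form Q" and "nondegenerate Q" and "hyperbolic Q"
    and "generator_classes Q n X1 X2"
    and "even d" and "2 \<le> d" and "d \<le> n"
    and "Y \<subseteq> generators Q n"
    and "\<forall>U\<in>Y. \<forall>W\<in>Y. U \<noteq> W \<longrightarrow> n - vec.dim (U \<inter> W) \<ge> d"
  shows "\<exists>Yhat. Yhat \<subseteq> X1 \<and> card Yhat = card Y \<and>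
           (\<forall>U\<in>Yhat. \<forall>W\<in>Yhat. U \<noteq> W \<longrightarrow> n - vec.dim (U \<inter> W) \<ge> d) \<and>
           half_code n X1 (d div 2) Yhat"
proof -
  have "witt_index Q \<le> n" using assms(4,7) by (simp add: hyperbolic_def)
  then obtain v where v: "Q v \<noteq> 0"
    and swap: "\<And>W. W \<in> generators Q n \<Longrightarrow> quadratic_reflection Q v ` W \<in> X1 \<longleftrightarrow> W \<notin> X1"
    using class_swapping_reflection[OF assms(5) _ assms(8)] by blast
  note classes = generator_classesD[OF assms(8)]
  let ?r = "quadratic_reflection Q v"
  define g where "g U = (if U \<in> X1 then U else ?r ` U)" for U
  have dist: "d \<le> n - vec.dim (U \<inter> W)" if "U \<in> Y" "W \<in> Y" "U \<noteq> W" for U W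
    using assms(13) that by blast
  have gen: "U \<in> generators Q n" if "U \<in> Y" for U using assms(12) that by blast
  have cross: "d \<le> n - vec.dim (U \<inter> ?r ` W)" if "U \<in> Y" "W \<in> Y" "U \<in> X1" "W \<notin> X1" for U W
  proof -
    have "U \<noteq> W" using that by blast
    then have "odd (n - vec.dim (U \<inter> W))"
      using classes(5)[OF gen gen, of U W] that dist[of U W] assms(10) by auto
    \<comment> \<open>An odd distance cannot equal the even \<open>d\<close>; the unit gained here
      pays for the one the reflection may cost.\<close>
    then have "Suc d \<le> n - vec.dim (U \<inter> W)"
      using dist[of U W] that assms(9) by (metis Suc_leI le_neq_implies_less)
    moreover have "vec.dim (U \<inter> ?r ` W) \<le> Suc (vec.dim (U \<inter> W))"
      using dim_Int_quadratic_reflection_le[OF assms(5) v] gen that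
      by (simp add: generators_def totally_singular_def)
    ultimately show ?thesis by linarith
  qed
  have g_dist: "d \<le> n - vec.dim (g U \<inter> g W)" if UW: "U \<in> Y" "W \<in> Y" "U \<noteq> W" for U W
  proof -
    \<comment> \<open>When both members are reflected, injectivity keeps their distance; only a
      mixed pair needs \<open>cross\<close>.\<close>
    have "?r ` U \<inter> ?r ` W = ?r ` (U \<inter> W)"
      using image_Int[OF inj_quadratic_reflection[OF assms(5) v]] by blast
    then have "vec.dim (?r ` U \<inter> ?r ` W) = vec.dim (U \<inter> W)"
      by (simp add: dim_quadratic_reflection_image[OF assms(5) v])
    then show ?thesis
      using dist[OF UW] cross[OF UW(1,2)] cross[OF UW(2,1)] by (auto simp: g_def Int_commute)
  qed
  have g_X1: "g ` Y \<subseteq> X1" using swap gen by (auto simp: g_def)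
  have inj: "inj_on g Y"
  proof (rule inj_onI, rule ccontr)
    fix U W assume UW: "U \<in> Y" "W \<in> Y" "g U = g W" "U \<noteq> W"
    have "g U \<in> generators Q n" using UW(1) g_X1 classes(1) by blast
    \<comment> \<open>Coinciding images would be at distance 0, below the positive bound
      \<open>d\<close> just shown for images.\<close>
    then have "vec.dim (g U \<inter> g W) = n" using UW(3) by (simp add: generators_def)
    then show False using g_dist[OF UW(1,2,4)] assms(10) by simp
  qed
  have code: "d \<le> n - vec.dim (U \<inter> W)" if "U \<in> g ` Y" "W \<in> g ` Y" "U \<noteq> W" for U W
    using that g_dist by blast
  have "half_code n X1 (d div 2) (g ` Y)"
    using half_codeI[OF _ g_X1 assms(11) code] classes(1) by blast
  then show ?thesis
    using g_X1 card_image[OF inj] code by blast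
qed

end
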